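(* There exists a critical set of size $121$ in the Latin square $L(16)$.
   Context: A Latin square $L$ of order $N$ is an $N\times N$ array, with rows and columns indexed by $\{0,\dots,N-1\}$, such that each row and each column contains each of the $N$ elements $0,\dots,N-1$ exactly once. It is identified with the set of its entries $(i,j;k)$, meaning that the cell in row $i$ and column $j$ contains $k$. A subset $C\subseteq L$ is uniquely completable (to $L$) if $L$ is the only Latin square of order $N$ (on the same rows, columns and elements) that contains $C$. A critical set of $L$ (or in $L$) is a subset $C\subseteq L$ that is uniquely completable to $L$ and such that no proper subset of $C$ is uniquely completable to $L$. Its size is its number of entries. $L(16)$ is the Latin square of order $16$ given by the Cayley table of the elementary abelian 2-group $(\mathbb{Z}/2)^4$; explicitly, the entry in row $i$ and column $j$, $0\le i,j\le 15$, is the bitwise exclusive-or (XOR) of $i$ and $j$. *)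

theory Defs
  imports Main
begin

text \<open>A square array on rows, columns and elements \<open>0, \<dots>, N - 1\<close> is identified with its set of
  entries \<open>(i, j, k)\<close>: the cell in row \<open>i\<close> and column \<open>j\<close> contains \<open>k\<close>.\<close>

type_synonym entry = "nat \<times> nat \<times> nat"

definition latin_square :: "nat \<Rightarrow> entry set \<Rightarrow> bool" where
  "latin_square N L \<longleftrightarrow>
     L \<subseteq> {..<N} \<times> {..<N} \<times> {..<N} \<and>
     (\<forall>i<N. \<forall>j<N. \<exists>!k. (i, j, k) \<in> L) \<and>
     (\<forall>i<N. \<forall>k<N. \<exists>!j. (i, j, k) \<in> L) \<and>
     (\<forall>j<N. \<forall>k<N. \<exists>!i. (i, j, k) \<in> L)"

definition uniquely_completable :: "nat \<Rightarrow> entry set \<Rightarrow> entry set \<Rightarrow> bool" where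
  "uniquely_completable N L C \<longleftrightarrow>
     latin_square N L \<and> C \<subseteq> L \<and> (\<forall>L'. latin_square N L' \<and> C \<subseteq> L' \<longrightarrow> L' = L)"

definition critical_set :: "nat \<Rightarrow> entry set \<Rightarrow> entry set \<Rightarrow> bool" where
  "critical_set N L C \<longleftrightarrow>
     uniquely_completable N L C \<and> (\<forall>D. D \<subset> C \<longrightarrow> \<not> uniquely_completable N L D)"

text \<open>The Cayley table of the elementary abelian 2-group of order 16, each group element being
  encoded by the number below 16 whose binary digits are its coordinates.\<close>

definition L16 :: "entry set" where
  "L16 = {(i, j, xor i j) | i j. i < 16 \<and> j < 16}"

end

theory Submission
  imports Defs
begin

text \<open>In a Cayley table of an elementary abelian 2-group every cell \<open>(i, j)\<close> and every
  \<open>d \<noteq> 0\<close> span an intercalate, i.e. a Latin subsquare of order 2: the four cells in rows \<open>i\<close>,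
  \<open>xor i d\<close> and columns \<open>j\<close>, \<open>xor j d\<close>. Both halves of criticality are read off from the
  intercalates through a cell.

  \<^item> Removing an entry of \<open>C\<close> destroys unique completability as soon as that entry is the only one
    of \<open>C\<close> in some intercalate, because exchanging the two elements of this intercalate yields
    another Latin square that contains all the other entries of \<open>C\<close>
    (\<open>not_uniquely_completable\<close>).

  \<^item> An empty cell is forced by the filled ones if all wrong elements are excluded from it, or if all
    wrong places for its element are excluded in its row or its column. A filled cell excluding
    the possibility that differs by \<open>d\<close> lies in the intercalate given by \<open>d\<close>
    (\<open>forced_entry\<close>). For the set used here such single deductions suffice to complete the square.

  The set \<open>C\<close> and its completion are recorded together in one table, which assigns rank 0 to the
  cells of \<open>C\<close> and to every other cell the round in which it is deduced. Unique completability
  follows by induction on the rank, and \<open>critical_set_rank\<close> reduces the theorem to a finite check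
  of local conditions on the table.\<close>

section \<open>Exclusive or on the numbers below a power of two\<close>

lemma xor_less:
  fixes a b :: nat
  assumes "a < 2 ^ n" "b < 2 ^ n"
  shows "xor a b < 2 ^ n"
  using assms by (metis take_bit_nat_eq_self take_bit_nat_less_exp take_bit_xor)

lemma xor_cancel [simp]: "xor (a::nat) (xor a b) = b" "xor (xor b a) a = b"
  by (simp_all flip: xor.assoc) (simp add: xor.assoc)

lemma xor_inj [simp]: "xor (a::nat) b = xor a c \<longleftrightarrow> b = c" "xor b a = xor c a \<longleftrightarrow> b = c"
  by (metis xor_cancel(1), metis xor_cancel(2))

lemma xor_pos: "a \<noteq> b \<Longrightarrow> 0 < xor a (b::nat)"
  by (metis gr_zeroI xor.right_neutral xor_cancel(1))

section \<open>Latin squares\<close>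

lemma
  assumes L: "latin_square N L"
  shows latin_square_bounds: "(i, j, k) \<in> L \<Longrightarrow> i < N \<and> j < N \<and> k < N"
    and latin_square_cell: "i < N \<Longrightarrow> j < N \<Longrightarrow> \<exists>k. (i, j, k) \<in> L"
    and latin_square_row: "i < N \<Longrightarrow> k < N \<Longrightarrow> \<exists>j. (i, j, k) \<in> L"
    and latin_square_col: "j < N \<Longrightarrow> k < N \<Longrightarrow> \<exists>i. (i, j, k) \<in> L"
    and latin_square_cell_unique: "(i, j, k) \<in> L \<Longrightarrow> (i, j, k') \<in> L \<Longrightarrow> k = k'"
    and latin_square_row_unique: "(i, j, k) \<in> L \<Longrightarrow> (i, j', k) \<in> L \<Longrightarrow> j = j'"
    and latin_square_col_unique: "(i, j, k) \<in> L \<Longrightarrow> (i', j, k) \<in> L \<Longrightarrow> i = i'"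
proof -
  have bounds: "i < N \<and> j < N \<and> k < N" if "(i, j, k) \<in> L" for i j k
    using L that by (auto simp: latin_square_def)
  have cell: "\<exists>!k. (i, j, k) \<in> L" if "i < N" "j < N" for i j
    using L that by (simp add: latin_square_def)
  have row: "\<exists>!j. (i, j, k) \<in> L" if "i < N" "k < N" for i k
    using L that by (simp add: latin_square_def)
  have col: "\<exists>!i. (i, j, k) \<in> L" if "j < N" "k < N" for j k
    using L that by (simp add: latin_square_def)
  show "(i, j, k) \<in> L \<Longrightarrow> i < N \<and> j < N \<and> k < N"
    by (rule bounds)
  show "\<exists>k. (i, j, k) \<in> L" if "i < N" "j < N"
    using cell[OF that] by (rule ex1_implies_ex)
  show "\<exists>j. (i, j, k) \<in> L" if "i < N" "k < N"
    using row[OF that] by (rule ex1_implies_ex)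
  show "\<exists>i. (i, j, k) \<in> L" if "j < N" "k < N"
    using col[OF that] by (rule ex1_implies_ex)
  show "k = k'" if "(i, j, k) \<in> L" "(i, j, k') \<in> L"
    using cell[of i j] bounds[OF that(1)] that by (metis (full_types))
  show "j = j'" if "(i, j, k) \<in> L" "(i, j', k) \<in> L"
    using row[of i k] bounds[OF that(1)] that by (metis (full_types))
  show "i = i'" if "(i, j, k) \<in> L" "(i', j, k) \<in> L"
    using col[of j k] bounds[OF that(1)] that by (metis (full_types))
qed

text \<open>Two Latin squares of the same order have the same number of entries, so inclusion is
  equality.\<close>

lemma latin_square_eqI:
  assumes L: "latin_square N L" and L': "latin_square N L'" and "L \<subseteq> L'"
  shows "L' = L"
proof
  show "L' \<subseteq> L"
  proof
    fix e assume "e \<in> L'"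
    obtain i j k where e: "e = (i, j, k)" by (cases e)
    with \<open>e \<in> L'\<close> have "i < N" "j < N"
      using latin_square_bounds[OF L'] by blast+
    then obtain k' where k': "(i, j, k') \<in> L"
      using latin_square_cell[OF L] by blast
    then have "k' = k"
      using latin_square_cell_unique[OF L'] \<open>e \<in> L'\<close> \<open>L \<subseteq> L'\<close> e by blast
    with k' show "e \<in> L"
      by (simp add: e)
  qed
qed (rule \<open>L \<subseteq> L'\<close>)

text \<open>Injectivity of all rows and columns is enough, since an injective map of a finite set into
  itself is surjective.\<close>

lemma latin_squareI:
  assumes range: "\<And>i j. i < N \<Longrightarrow> j < N \<Longrightarrow> f i j < N"
    and row: "\<And>i j j'. i < N \<Longrightarrow> j < N \<Longrightarrow> j' < N \<Longrightarrow> f i j = f i j' \<Longrightarrow> j = j'"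
    and col: "\<And>i i' j. i < N \<Longrightarrow> i' < N \<Longrightarrow> j < N \<Longrightarrow> f i j = f i' j \<Longrightarrow> i = i'"
  shows "latin_square N {(i, j, f i j) | i j. i < N \<and> j < N}"
proof -
  have surj: "\<exists>x<N. g x = k"
    if "\<And>x. x < N \<Longrightarrow> g x < N" "inj_on g {..<N}" "k < N" for g and k :: nat
  proof -
    have "g ` {..<N} \<subseteq> {..<N}"
      using that(1) by blast
    then have "g ` {..<N} = {..<N}"
      using endo_inj_surj that(2) by blast
    then have "k \<in> g ` {..<N}"
      using that(3) by blast
    then show ?thesis by blast
  qed
  have rows: "\<exists>j<N. f i j = k" if "i < N" "k < N" for i k
    by (rule surj) (blast intro: inj_onI range row that)+
  have cols: "\<exists>i<N. f i j = k" if "j < N" "k < N" for j k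
    by (rule surj[of "\<lambda>i. f i j"]) (blast intro: inj_onI range col that)+
  show ?thesis
    unfolding latin_square_def
  proof (intro conjI allI impI)
    fix i k assume "i < N" "k < N"
    with rows obtain j where "j < N" "f i j = k" by blast
    with \<open>i < N\<close> row show "\<exists>!j. (i, j, k) \<in> {(i, j, f i j) | i j. i < N \<and> j < N}"
      by (intro ex1I[of _ j]) auto
  next
    fix j k assume "j < N" "k < N"
    with cols obtain i where "i < N" "f i j = k" by blast
    with \<open>j < N\<close> col show "\<exists>!i. (i, j, k) \<in> {(i, j, f i j) | i j. i < N \<and> j < N}"
      by (intro ex1I[of _ i]) auto
  qed (use range in auto)
qed

section \<open>The exclusive-or table and its intercalates\<close>

definition xor_table :: "nat \<Rightarrow> entry set" where
  "xor_table N = {(i, j, xor i j) | i j. i < N \<and> j < N}"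

lemma latin_square_xor_table: "latin_square (2 ^ n) (xor_table (2 ^ n))"
  unfolding xor_table_def by (rule latin_squareI) (auto intro: xor_less)

text \<open>The intercalate through \<open>(i, j)\<close> given by \<open>d\<close> contains just the two elements \<open>xor i j\<close> and
  \<open>xor (xor i j) d\<close>, so adding \<open>d\<close> to its four entries exchanges them.\<close>

definition switched :: "nat \<Rightarrow> nat \<Rightarrow> nat \<Rightarrow> nat \<Rightarrow> nat \<Rightarrow> nat" where
  "switched i j d a b =
     (if a \<in> {i, xor i d} \<and> b \<in> {j, xor j d} then xor (xor a b) d else xor a b)"

lemma latin_square_switched:
  assumes "i < 2 ^ n" "j < 2 ^ n" "d < 2 ^ n"
  shows "latin_square (2 ^ n) {(a, b, switched i j d a b) | a b. a < 2 ^ n \<and> b < 2 ^ n}"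
proof (rule latin_squareI)
  show "switched i j d a b < 2 ^ n" if "a < 2 ^ n" "b < 2 ^ n" for a b
    using that assms by (auto simp: switched_def intro!: xor_less)
next
  fix a b b' assume "switched i j d a b = switched i j d a b'"
  then show "b = b'"
    by (auto simp: switched_def xor.assoc split: if_splits)
next
  fix a a' b assume "switched i j d a b = switched i j d a' b"
  then show "a = a'"
    by (auto simp: switched_def xor.assoc xor.left_commute[of _ b] xor.commute[of _ b] split: if_splits)
qed

section \<open>Deduction of single entries\<close>

text \<open>The three alternatives stand for the cell \<open>(i, j)\<close>, for the element \<open>xor i j\<close> in row \<open>i\<close>, and
  for that element in column \<open>j\<close>. In the first one, the wrong element \<open>xor (xor i j) d\<close> is excluded
  because it is already present in row \<open>i\<close>, which happens at column \<open>xor j d\<close>, or in column \<open>j\<close>,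
  which happens at row \<open>xor i d\<close>. In the second one, the wrong column \<open>xor j d\<close> is excluded because
  its cell in row \<open>i\<close> is filled, or because it contains \<open>xor i j\<close> already, which happens at row
  \<open>xor i d\<close>. The third one is the second with rows and columns interchanged. So in each of them the
  witness for \<open>d\<close> is one of two fixed corners of the intercalate given by \<open>d\<close>.\<close>

definition forced :: "nat \<Rightarrow> (nat \<Rightarrow> nat \<Rightarrow> bool) \<Rightarrow> nat \<Rightarrow> nat \<Rightarrow> bool" where
  "forced N K i j \<longleftrightarrow>
     (\<forall>d\<in>{0<..<N}. K i (xor j d) \<or> K (xor i d) j) \<or>
     (\<forall>d\<in>{0<..<N}. K i (xor j d) \<or> K (xor i d) (xor j d)) \<or>
     (\<forall>d\<in>{0<..<N}. K (xor i d) j \<or> K (xor i d) (xor j d))"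

definition filled :: "nat \<Rightarrow> (nat \<Rightarrow> nat \<Rightarrow> bool) \<Rightarrow> entry set" where
  "filled N K = {(i, j, xor i j) | i j. i < N \<and> j < N \<and> K i j}"

lemma forced_entry:
  fixes n defines "N \<equiv> 2 ^ n"
  assumes L: "latin_square N L" and "i < N" "j < N"
    and K: "\<And>a b. a < N \<Longrightarrow> b < N \<Longrightarrow> K a b \<Longrightarrow> (a, b, xor a b) \<in> L"
    and forced: "forced N K i j"
  shows "(i, j, xor i j) \<in> L"
proof -
  have xor_N: "xor a b < N" if "a < N" "b < N" for a b
    using that unfolding N_def by (rule xor_less)
  note bound = latin_square_bounds[OF L]
    and cell = latin_square_cell_unique[OF L]
    and row = latin_square_row_unique[OF L]
    and col = latin_square_col_unique[OF L]
  have step: "xor a b \<in> {0<..<N}" if "a < N" "b < N" "a \<noteq> b" for a b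
    using xor_N[OF that(1,2)] xor_pos[OF that(3)] by simp
  have K': "K i (xor j d) \<Longrightarrow> (i, xor j d, xor i (xor j d)) \<in> L"
    "K (xor i d) j \<Longrightarrow> (xor i d, j, xor (xor i d) j) \<in> L"
    "K (xor i d) (xor j d) \<Longrightarrow> (xor i d, xor j d, xor (xor i d) (xor j d)) \<in> L"
    if "d \<in> {0<..<N}" for d
    using that assms(3,4) by (auto intro!: K xor_N)
  have shift: "xor a d \<noteq> a" if "d \<in> {0<..<N}" for a d
    using that by (metis greaterThanLessThan_iff less_irrefl xor.right_neutral xor_inj(1))
  from forced consider
      (cell) "\<And>d. d \<in> {0<..<N} \<Longrightarrow> K i (xor j d) \<or> K (xor i d) j"
    | (row) "\<And>d. d \<in> {0<..<N} \<Longrightarrow> K i (xor j d) \<or> K (xor i d) (xor j d)"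
    | (col) "\<And>d. d \<in> {0<..<N} \<Longrightarrow> K (xor i d) j \<or> K (xor i d) (xor j d)"
    unfolding forced_def by blast
  then show ?thesis
  proof cases
    case cell
    obtain k where k: "(i, j, k) \<in> L"
      using latin_square_cell[OF L \<open>i < N\<close> \<open>j < N\<close>] by blast
    have "k = xor i j"
    proof (rule ccontr)
      define d where "d = xor (xor i j) k"
      assume "k \<noteq> xor i j"
      then have d: "d \<in> {0<..<N}" and kd: "k = xor (xor i j) d"
        using bound[OF k] step[OF xor_N, OF \<open>i < N\<close> \<open>j < N\<close>, of k] by (auto simp: d_def)
      from cell[OF d] have "(i, xor j d, k) \<in> L \<or> (xor i d, j, k) \<in> L"
        using K'[OF d] by (auto simp: kd ac_simps)
      then show False
        using row[OF k] col[OF k] shift[OF d] by metis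
    qed
    with k show ?thesis by simp
  next
    case row
    obtain b where b: "(i, b, xor i j) \<in> L"
      using latin_square_row[OF L \<open>i < N\<close> xor_N[OF \<open>i < N\<close> \<open>j < N\<close>]] by blast
    have "b = j"
    proof (rule ccontr)
      define d where "d = xor j b"
      assume "b \<noteq> j"
      then have d: "d \<in> {0<..<N}" and bd: "xor j d = b"
        using bound[OF b] step[OF \<open>j < N\<close>, of b] by (auto simp: d_def)
      have sym: "xor (xor i d) b = xor i j" "xor i b = xor (xor i j) d"
        by (simp_all add: ac_simps flip: bd)
      from row[OF d] have "(i, b, xor (xor i j) d) \<in> L \<or> (xor i d, b, xor i j) \<in> L"
        using K'[OF d] by (auto simp: bd sym)
      then show False
        using cell[OF b] col[OF b] shift[OF d] by metis
    qed
    with b show ?thesis by simp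
  next
    case col
    obtain a where a: "(a, j, xor i j) \<in> L"
      using latin_square_col[OF L \<open>j < N\<close> xor_N[OF \<open>i < N\<close> \<open>j < N\<close>]] by blast
    have "a = i"
    proof (rule ccontr)
      define d where "d = xor i a"
      assume "a \<noteq> i"
      then have d: "d \<in> {0<..<N}" and ad: "xor i d = a"
        using bound[OF a] step[OF \<open>i < N\<close>, of a] by (auto simp: d_def)
      have sym: "xor a (xor j d) = xor i j" "xor a j = xor (xor i j) d"
        by (simp_all add: ac_simps flip: ad)
      from col[OF d] have "(a, j, xor (xor i j) d) \<in> L \<or> (a, xor j d, xor i j) \<in> L"
        using K'[OF d] by (auto simp: ad sym)
      then show False
        using cell[OF a] row[OF a] shift[OF d] by metis
    qed
    with a show ?thesis by simp
  qed
qed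

text \<open>The ranks order the deductions: an entry may use only entries of smaller rank, so a completion
  agrees with the table on all cells by induction on the rank.\<close>

lemma uniquely_completable_rank:
  fixes n defines "N \<equiv> 2 ^ n"
  assumes rank: "\<And>i j. i < N \<Longrightarrow> j < N \<Longrightarrow> r i j \<noteq> 0 \<Longrightarrow> forced N (\<lambda>a b. r a b < r i j) i j"
  shows "uniquely_completable N (xor_table N) (filled N (\<lambda>i j. r i j = (0::nat)))"
    (is "uniquely_completable N _ ?C")
  unfolding uniquely_completable_def
proof (intro conjI allI impI)
  show latin: "latin_square N (xor_table N)"
    unfolding N_def by (rule latin_square_xor_table)
  show "?C \<subseteq> xor_table N"
    by (auto simp: filled_def xor_table_def)
  fix L assume L: "latin_square N L \<and> ?C \<subseteq> L"
  have "(i, j, xor i j) \<in> L" if "i < N" "j < N" for i j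
    using that
  proof (induction "r i j" arbitrary: i j rule: less_induct)
    case less
    show ?case
    proof (cases "r i j = 0")
      case True
      then show ?thesis using less.prems L unfolding filled_def by blast
    next
      case False
      show ?thesis
      proof (rule forced_entry)
        show "latin_square (2 ^ n) L" "i < 2 ^ n" "j < 2 ^ n"
          using L less.prems by (simp_all add: N_def)
        show "(a, b, xor a b) \<in> L" if "a < 2 ^ n" "b < 2 ^ n" "r a b < r i j" for a b
          using less.hyps that by (simp add: N_def)
        show "forced (2 ^ n) (\<lambda>a b. r a b < r i j) i j"
          using rank[OF less.prems False] by (simp add: N_def)
      qed
    qed
  qed
  then have "xor_table N \<subseteq> L"
    by (auto simp: xor_table_def)
  with latin show "L = xor_table N"
    using latin_square_eqI[of N "xor_table N" L] L by simp
qed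

section \<open>Criticality\<close>

definition sole_in_intercalate :: "nat \<Rightarrow> (nat \<Rightarrow> nat \<Rightarrow> bool) \<Rightarrow> nat \<Rightarrow> nat \<Rightarrow> bool" where
  "sole_in_intercalate N K i j \<longleftrightarrow>
     (\<exists>d\<in>{0<..<N}. \<not> K i (xor j d) \<and> \<not> K (xor i d) j \<and> \<not> K (xor i d) (xor j d))"

text \<open>Exchanging the two elements of the intercalate leaves all entries of \<open>D\<close> in place and changes
  the table.\<close>

lemma not_uniquely_completable:
  fixes n defines "N \<equiv> 2 ^ n"
  assumes "i < N" "j < N" and sole_in_intercalate: "sole_in_intercalate N K i j"
    and D: "D \<subseteq> filled N K" "(i, j, xor i j) \<notin> D"
  shows "\<not> uniquely_completable N (xor_table N) D"
proof -
  obtain d where d: "d \<in> {0<..<N}"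
      and free: "\<not> K i (xor j d)" "\<not> K (xor i d) j" "\<not> K (xor i d) (xor j d)"
    using sole_in_intercalate unfolding sole_in_intercalate_def by blast
  define S where "S = {(a, b, switched i j d a b) | a b. a < N \<and> b < N}"
  have "latin_square N S"
    using assms(2,3) d unfolding S_def N_def by (intro latin_square_switched) auto
  moreover have "D \<subseteq> S"
  proof
    fix e assume "e \<in> D"
    with D obtain a b where e: "e = (a, b, xor a b)" "a < N" "b < N" "K a b" "(a, b) \<noteq> (i, j)"
      unfolding filled_def by blast
    then have "switched i j d a b = xor a b"
      using free by (auto simp: switched_def)
    with e show "e \<in> S"
      unfolding S_def by (auto intro!: exI[of _ a] exI[of _ b])
  qed
  moreover have "(i, j, xor i j) \<in> xor_table N - S"
  proof -
    have "switched i j d i j \<noteq> xor i j"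
      using d xor_inj(1)[of "xor i j" d 0] by (simp add: switched_def del: xor_inj)
    then show ?thesis
      using assms(2,3) by (auto simp: S_def xor_table_def)
  qed
  ultimately show ?thesis
    unfolding uniquely_completable_def by blast
qed

text \<open>A proper subset misses some entry of the whole set, so it is enough to treat the subsets that
  avoid one given entry.\<close>

lemma critical_set_rank:
  fixes r :: "nat \<Rightarrow> nat \<Rightarrow> nat" and n
  defines "N \<equiv> 2 ^ n" and "K \<equiv> \<lambda>i j. r i j = 0"
  assumes rank: "\<And>i j. i < N \<Longrightarrow> j < N \<Longrightarrow>
    if r i j = 0 then sole_in_intercalate N K i j else forced N (\<lambda>a b. r a b < r i j) i j"
  shows "critical_set N (xor_table N) (filled N K)"
  unfolding critical_set_def
proof (intro conjI allI impI)
  show "uniquely_completable N (xor_table N) (filled N K)"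
    unfolding N_def K_def
  proof (rule uniquely_completable_rank)
    fix i j assume "i < 2 ^ n" "j < 2 ^ n" "r i j \<noteq> 0"
    then show "forced (2 ^ n) (\<lambda>a b. r a b < r i j) i j"
      using rank[of i j] by (simp add: N_def)
  qed
  fix D assume "D \<subset> filled N K"
  then obtain i j where ij: "i < N" "j < N" "K i j" "(i, j, xor i j) \<notin> D" and "D \<subseteq> filled N K"
    unfolding filled_def by blast
  have "sole_in_intercalate N K i j"
    using rank[OF ij(1,2)] ij(3) by (simp add: K_def)
  from not_uniquely_completable[OF ij(1,2)[unfolded N_def] this[unfolded N_def]
      \<open>D \<subseteq> filled N K\<close>[unfolded N_def] ij(4)]
  show "\<not> uniquely_completable N (xor_table N) D"
    unfolding N_def .
qed

section \<open>A set of 121 entries\<close>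

text \<open>The cells marked 0 were found by a computer search for small sets that meet the difference of
  the table from every other Latin square. All other numbers follow from them: if in each round all
  cells that are forced by the filled ones are filled simultaneously, the number is the round in
  which the cell is filled.\<close>

definition rank_table :: "nat list list" where
  "rank_table = [
    [14, 13,  0,  0,  0,  0, 16,  0,  0,  0,  9,  8, 16, 15,  0, 14],
    [ 0, 16,  0,  0,  0, 16, 16,  0,  3,  0,  0, 15, 15,  0, 15, 16],
    [ 0, 15, 16,  0,  0, 16,  0,  9,  0, 14,  0,  5, 17, 16, 17,  0],
    [14,  0,  3,  0, 14,  2,  4,  3, 13,  0,  2,  0,  0,  0, 13,  0],
    [ 0,  0, 16,  6, 15,  0, 17, 15,  0, 13,  5, 14, 16,  0,  0,  0],
    [ 0,  0,  0,  1, 14, 15, 14,  0, 12, 13, 10,  0,  0, 15,  0,  0],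
    [ 2, 12,  0,  7, 11,  0,  0, 12,  4,  0,  5, 11,  0,  0,  0,  0],
    [15,  0,  0,  8,  0, 16, 13, 16, 11,  0,  0, 14,  0, 17,  0,  9],
    [10,  0, 13,  7, 14,  0,  0,  0,  8,  0,  0, 13,  8,  9, 12,  0],
    [ 0,  8,  0,  8,  0,  0,  0,  0, 11, 11,  9, 10, 10,  0, 11, 12],
    [ 0, 15,  7,  1,  0,  0, 15, 14, 12,  0,  6,  0,  0, 15,  0,  8],
    [16, 16, 16,  0, 15,  0,  0, 15,  0, 14,  0,  0, 16, 16,  0, 15],
    [16, 14, 17,  0,  0, 17, 15,  0,  0,  9,  0,  0,  0,  0, 17, 15],
    [ 0,  0, 14,  6,  0, 16, 16, 16,  0, 15,  0,  0, 15,  0, 16,  0],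
    [17,  0,  0,  0, 16, 17,  0, 17,  0,  0,  0,  0, 17, 16, 17, 14],
    [ 0,  1,  0,  0, 15,  0, 16, 16,  0,  0,  0,  4,  0, 16, 15,  0]]"

definition rank :: "nat \<Rightarrow> nat \<Rightarrow> nat" where
  "rank i j = rank_table ! i ! j"

text \<open>The comparison of whole lists yields the 256 values of \<open>rank\<close> as separate rewrite rules, so that
  a lookup in the finite check is one rewrite step.\<close>

lemma rank_eqs:
  "map (\<lambda>i. map (rank i) [0..<16]) [0..<16] = rank_table"
proof -
  have len: "length rank_table = 16" "list_all (\<lambda>xs. length xs = 16) rank_table"
    by (simp_all add: rank_table_def)
  then have "map (rank i) [0..<16] = rank_table ! i" if "i < 16" for i
    using that map_nth[of "rank_table ! i"]
    by (auto simp: rank_def[abs_def] list_all_length)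
  then show ?thesis
    using len by (intro nth_equalityI) auto
qed

lemma upt_16: "[0..<16] = [0, 1, 2, 3, 4, 5, 6, 7, 8, 9, 10, 11, 12, 13, 14, 15]"
  by code_simp

lemma interval_16: "{0<..<16} = {1, 2, 3, 4, 5, 6, 7, 8, 9, 10, 11, 12, 13, 14, 15 :: nat}"
proof -
  have "[Suc 0..<16] = [1, 2, 3, 4, 5, 6, 7, 8, 9, 10, 11, 12, 13, 14, 15]"
    by code_simp
  then show ?thesis
    by (simp add: greaterThanLessThan_upt del: set_upt)
qed

lemmas rank_simps = rank_eqs[unfolded upt_16 rank_table_def, simplified]

lemma rank_check:
  "\<forall>i\<in>set [0..<16]. \<forall>j\<in>set [0..<16].
     if rank i j = 0 then sole_in_intercalate 16 (\<lambda>a b. rank a b = 0) i j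
     else forced 16 (\<lambda>a b. rank a b < rank i j) i j"
  by (simp add: rank_simps upt_16 forced_def sole_in_intercalate_def interval_16
      numeral_3_eq_3[symmetric] del: set_upt)

lemma card_filled_rank: "card (filled 16 (\<lambda>i j. rank i j = 0)) = 121"
proof -
  let ?cs = "filter (\<lambda>(i, j). rank i j = 0) (List.product [0..<16] [0..<16])"
  have "length ?cs = 121"
    by (simp add: rank_simps upt_16)
  moreover have "distinct ?cs"
    by (intro distinct_filter distinct_product distinct_upt)
  ultimately have "card (set ?cs) = 121"
    by (simp only: distinct_card)
  moreover have "filled 16 (\<lambda>i j. rank i j = 0) = (\<lambda>(i, j). (i, j, xor i j)) ` set ?cs"
    by (auto simp: filled_def image_iff)
  moreover have "inj_on (\<lambda>(i, j). (i, j, xor i j)) (set ?cs)"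
    by (auto intro: inj_onI)
  ultimately show ?thesis
    by (simp only: card_image)
qed

theorem mainTheorem3: "\<exists>C. critical_set 16 L16 C \<and> card C = 121"
proof (intro exI conjI)
  have pow: "2 ^ 4 = (16 :: nat)"
    by simp
  have L16: "xor_table 16 = L16"
    by (simp only: L16_def xor_table_def)
  have "if rank i j = 0 then sole_in_intercalate 16 (\<lambda>a b. rank a b = 0) i j
      else forced 16 (\<lambda>a b. rank a b < rank i j) i j" if "i < 16" "j < 16" for i j
  proof -
    have "i \<in> set [0..<16]" "j \<in> set [0..<16]"
      using that by simp_all
    then show ?thesis
      using rank_check by blast
  qed
  then show "critical_set 16 L16 (filled 16 (\<lambda>i j. rank i j = 0))"
    by (rule critical_set_rank[of 4 rank, unfolded pow L16])
  show "card (filled 16 (\<lambda>i j. rank i j = 0)) = 121"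
    by (rule card_filled_rank)
qed

end
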